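(* Let $k\in\frac12\mathbb{Z}$, let $V$ be a complex vector space, and let $\rho:\widetilde{\mathrm{GL}_2}(\mathbb{Z})\to \mathrm{GL}(V)$ be a representation. Let $\mathrm{Res}\,\rho$ denote the restriction of $\rho$ to $\widetilde{\mathrm{SL}_2}(\mathbb{Z})$. Then the restriction map $$\mathrm{Res}: M_k(\widetilde{\mathrm{GL}_2}(\mathbb{Z}),\rho)\to M_k(\widetilde{\mathrm{SL}_2}(\mathbb{Z}),\mathrm{Res}\,\rho),\qquad f\mapsto f|_{\mathbb{H}^+},$$ is an isomorphism (of complex vector spaces).
   Context: **Half-planes.** $\mathbb{H}^{+}=\{z\in\mathbb{C}: \Im z>0\}$, $\mathbb{H}^{-}=\{z\in\mathbb{C}: \Im z<0\}$, $\mathbb{H}^*=\mathbb{H}^+\cup\mathbb{H}^-$. $\mathrm{GL}_2(\mathbb{Z})$ acts on $\mathbb{H}^*$ by $\left(\begin{smallmatrix}a&b\\c&d\end{smallmatrix}\right)z=\frac{az+b}{cz+d}$. Put $R=\left(\begin{smallmatrix}-1&0\\0&1\end{smallmatrix}\right)$, so $Rz=-z$. **The group $\widetilde{\mathrm{GL}_2}(\mathbb{Z})$.** For $\gamma=\left(\begin{smallmatrix}a&b\\c&d\end{smallmatrix}\right)\in\mathrm{GL}_2(\mathbb{Z})$ let $\chi(\gamma)=c$ if $c\neq0$ and $\chi(\gamma)=d$ if $c=0$. For nonzero reals $a,b$ let $(a,b)=-1$ if $a<0$ and $b<0$, and $(a,b)=1$ otherwise. For $\alpha,\beta\in\mathrm{GL}_2(\mathbb{Z})$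 set $$A(\alpha,\beta)=(\det\alpha,\det\beta)\left(\frac{\chi(\alpha\beta)}{\chi(\alpha)},\frac{\chi(\alpha\beta)}{\chi(\beta)\det\alpha}\right)\in\{\pm1\}.$$ This is a $2$-cocycle. $\widetilde{\mathrm{GL}_2}(\mathbb{Z})$ is the group of pairs $[\gamma,\epsilon]$ with $\gamma\in\mathrm{GL}_2(\mathbb{Z})$, $\epsilon\in\{\pm1\}$, and product $[\alpha,\epsilon][\beta,\delta]=[\alpha\beta,A(\alpha,\beta)\epsilon\delta]$. For $\gamma\in\mathrm{SL}_2(\mathbb{Z})$ set $B(\gamma)=(\chi(\gamma),\chi(\gamma R))$ (the Hilbert symbol, i.e. $B(\gamma)=-1$ if $\chi(\gamma)<0$ and $\chi(\gamma R)<0$, and $B(\gamma)=1$ otherwise). **The group $\widetilde{\mathrm{SL}_2}(\mathbb{Z})$.** It is the group of pairs $(\gamma,\phi)$ with $\gamma=\left(\begin{smallmatrix}*&*\\c&d\end{smallmatrix}\right)\in\mathrm{SL}_2(\mathbb{Z})$ and $\phi$ holomorphic on $\mathbb{H}^+$ with $\phi(z)^2=cz+d$, with product $(\alpha,\phi(z))(\beta,\psi(z))=(\alpha\beta,\phi(\beta z)\psi(z))$. Fix an embedding $\iota:\widetilde{\mathrm{SL}_2}(\mathbb{Z})\to\widetilde{\mathrm{GL}_2}(\mathbb{Z})$ lifting the inclusion $\mathrm{SL}_2(\mathbb{Z})\subset\mathrm{GL}_2(\mathbb{Z})$ (i.e. $\iota(\alpha,\phi)=[\beta,\epsilon]$ implies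 $\alpha=\beta$); such embeddings exist, and the image is $\{[\gamma,\epsilon]:\det\gamma=1\}$. Identify $\widetilde{\mathrm{SL}_2}(\mathbb{Z})$ with this image. For $\gamma\in\mathrm{SL}_2(\mathbb{Z})$ let $\phi_\gamma^+:\mathbb{H}^+\to\mathbb{C}$ be the function with $\iota(\gamma,\phi_\gamma^+)=[\gamma,1]$; then $\iota(\gamma,\epsilon\phi^+_\gamma)=[\gamma,\epsilon]$. **Weight $k$ action** ($k\in\frac12\mathbb{Z}$). For a function $f$ on $\mathbb{H}^*$ (with values in $\mathbb{C}$ or a complex vector space) write $f^\pm=f|_{\mathbb{H}^\pm}$. For $[\gamma,\epsilon]\in\widetilde{\mathrm{GL}_2}(\mathbb{Z})$ define $f|_k[\gamma,\epsilon]$ by: - if $\det\gamma=1$: $(f|_k[\gamma,\epsilon])^+(z)=f^+(\gamma z)(\epsilon\phi_\gamma^+(z))^{-2k}$ and $(f|_k[\gamma,\epsilon])^-(z)=f^-(\gamma z)(\epsilon B(\gamma)\phi^+_{R\gamma R}(-z))^{-2k}$; - if $\det\gamma=-1$: $(f|_k[\gamma,\epsilon])^+(z)=f^-(\gamma z)(i\epsilon A(R,\gamma)\phi^+_{R\gamma}(z))^{-2k}$ and $(f|_k[\gamma,\epsilon])^-(z)=f^+(\gamma z)(i\epsilon A(R,\gamma)B(R\gamma)\phi^+_{\gamma R}(-z))^{-2k}$. For $f$ defined only on $\mathbb{H}^+$ and $[\gamma,\epsilon]$ with $\det\gamma=1$, $(f|_k[\gamma,\epsilon])(z)=f(\gamma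 z)(\epsilon\phi^+_\gamma(z))^{-2k}$. **Modular forms.** A function $f$ with values in a complex vector space $V$ is holomorphic if $\lambda\circ f$ is holomorphic for every linear functional $\lambda:V\to\mathbb{C}$. For a representation $\rho:\widetilde{\mathrm{GL}_2}(\mathbb{Z})\to\mathrm{GL}(V)$, $M_k(\widetilde{\mathrm{GL}_2}(\mathbb{Z}),\rho)$ is the space of holomorphic $f:\mathbb{H}^*\to V$ with $f|_k\tilde\gamma=\rho(\tilde\gamma)f$ for all $\tilde\gamma\in\widetilde{\mathrm{GL}_2}(\mathbb{Z})$. For a representation $\rho:\widetilde{\mathrm{SL}_2}(\mathbb{Z})\to\mathrm{GL}(V)$, $M_k(\widetilde{\mathrm{SL}_2}(\mathbb{Z}),\rho)$ is the space of holomorphic $f:\mathbb{H}^+\to V$ with $f|_k\tilde\gamma=\rho(\tilde\gamma)f$ for all $\tilde\gamma\in\widetilde{\mathrm{SL}_2}(\mathbb{Z})$. (No growth condition is imposed in either case.) *)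

theory Defs
  imports
    "HOL-Analysis.Analysis"
    "HOL-Algebra.Group"
    "HOL-Library.Function_Algebras"
begin

text \<open>
  Functions on a subset of the complex plane are represented by total functions that vanish
  off that subset. In this way the functions on a fixed subset form a linear subspace, and
  equality of such functions is equality in HOL.
\<close>

definition upper_hp :: "complex set" where
  "upper_hp = {z. Im z > 0}"

definition lower_hp :: "complex set" where
  "lower_hp = {z. Im z < 0}"

definition double_hp :: "complex set" where
  "double_hp = upper_hp \<union> lower_hp"

definition vanishes_off :: "complex set \<Rightarrow> (complex \<Rightarrow> 'v::zero) \<Rightarrow> bool" where
  "vanishes_off H f \<longleftrightarrow> (\<forall>z. z \<notin> H \<longrightarrow> f z = 0)"

type_synonym mat2 = "int ^ 2 ^ 2"

definition mobius :: "mat2 \<Rightarrow> complex \<Rightarrow> complex" where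
  "mobius \<gamma> z =
     (of_int (\<gamma> $ 1 $ 1) * z + of_int (\<gamma> $ 1 $ 2)) / (of_int (\<gamma> $ 2 $ 1) * z + of_int (\<gamma> $ 2 $ 2))"

definition Rmat :: mat2 where
  "Rmat = vector [vector [-1, 0], vector [0, 1]]"

definition chi :: "mat2 \<Rightarrow> int" where
  "chi \<gamma> = (if \<gamma> $ 2 $ 1 \<noteq> 0 then \<gamma> $ 2 $ 1 else \<gamma> $ 2 $ 2)"

definition hilbert_symbol :: "real \<Rightarrow> real \<Rightarrow> int" where
  "hilbert_symbol a b = (if a < 0 \<and> b < 0 then -1 else 1)"

definition cocycle_A :: "mat2 \<Rightarrow> mat2 \<Rightarrow> int" where
  "cocycle_A \<alpha> \<beta> =
     hilbert_symbol (of_int (det \<alpha>)) (of_int (det \<beta>)) *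
     hilbert_symbol (of_int (chi (\<alpha> ** \<beta>)) / of_int (chi \<alpha>))
             (of_int (chi (\<alpha> ** \<beta>)) / (of_int (chi \<beta>) * of_int (det \<alpha>)))"

definition sign_B :: "mat2 \<Rightarrow> int" where
  "sign_B \<gamma> = hilbert_symbol (of_int (chi \<gamma>)) (of_int (chi (\<gamma> ** Rmat)))"

definition GL2_tilde :: "(mat2 \<times> int) monoid" where
  "GL2_tilde =
     \<lparr>carrier = {\<gamma>. invertible \<gamma>} \<times> {1, -1},
      mult = (\<lambda>(\<alpha>, \<epsilon>) (\<beta>, \<delta>). (\<alpha> ** \<beta>, cocycle_A \<alpha> \<beta> * \<epsilon> * \<delta>)),
      one = (mat 1, 1)\<rparr>"

text \<open>
  In the product below the function component vanishes off the upper half-plane because its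
  second factor does.
\<close>

definition SL2_tilde :: "(mat2 \<times> (complex \<Rightarrow> complex)) monoid" where
  "SL2_tilde =
     \<lparr>carrier = {(\<gamma>, \<phi>). det \<gamma> = 1 \<and> \<phi> holomorphic_on upper_hp \<and> vanishes_off upper_hp \<phi> \<and>
                  (\<forall>z\<in>upper_hp. (\<phi> z)\<^sup>2 = of_int (\<gamma> $ 2 $ 1) * z + of_int (\<gamma> $ 2 $ 2))},
      mult = (\<lambda>(\<alpha>, \<phi>) (\<beta>, \<psi>). (\<alpha> ** \<beta>, \<lambda>z. \<phi> (mobius \<beta> z) * \<psi> z)),
      one = (mat 1, \<lambda>z. if z \<in> upper_hp then 1 else 0)\<rparr>"

type_synonym cover_map = "mat2 \<times> (complex \<Rightarrow> complex) \<Rightarrow> mat2 \<times> int"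

definition lifting_embedding :: "cover_map \<Rightarrow> bool" where
  "lifting_embedding \<iota> \<longleftrightarrow>
     \<iota> \<in> hom SL2_tilde GL2_tilde \<and> inj_on \<iota> (carrier SL2_tilde) \<and>
     (\<forall>x\<in>carrier SL2_tilde. fst (\<iota> x) = fst x)"

definition phi_plus :: "cover_map \<Rightarrow> mat2 \<Rightarrow> complex \<Rightarrow> complex" where
  "phi_plus \<iota> \<gamma> = (THE \<phi>. (\<gamma>, \<phi>) \<in> carrier SL2_tilde \<and> \<iota> (\<gamma>, \<phi>) = (\<gamma>, 1))"

text \<open>
  The weight \<open>k\<close> is a real number with \<open>2 * k\<close> an integer, so that the exponent \<open>- 2 * k\<close> is
  the integer \<open>- \<lfloor>2 * k\<rfloor>\<close>. The argument \<open>smul\<close> is the scalar multiplication of the complex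
  vector space in which the functions take their values.
\<close>

definition slash_GL ::
  "cover_map \<Rightarrow> (complex \<Rightarrow> 'v \<Rightarrow> 'v) \<Rightarrow> real \<Rightarrow> (complex \<Rightarrow> 'v::zero) \<Rightarrow> mat2 \<times> int \<Rightarrow> complex \<Rightarrow> 'v"
where
  "slash_GL \<iota> smul k f = (\<lambda>(\<gamma>, \<epsilon>) z.
     if z \<in> upper_hp then
       (if det \<gamma> = 1
        then smul ((of_int \<epsilon> * phi_plus \<iota> \<gamma> z) powi (- \<lfloor>2 * k\<rfloor>)) (f (mobius \<gamma> z))
        else smul ((\<i> * of_int \<epsilon> * of_int (cocycle_A Rmat \<gamma>) * phi_plus \<iota> (Rmat ** \<gamma>) z)
                      powi (- \<lfloor>2 * k\<rfloor>)) (f (mobius \<gamma> z)))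
     else if z \<in> lower_hp then
       (if det \<gamma> = 1
        then smul ((of_int \<epsilon> * of_int (sign_B \<gamma>) * phi_plus \<iota> (Rmat ** \<gamma> ** Rmat) (- z))
                      powi (- \<lfloor>2 * k\<rfloor>)) (f (mobius \<gamma> z))
        else smul ((\<i> * of_int \<epsilon> * of_int (cocycle_A Rmat \<gamma>) * of_int (sign_B (Rmat ** \<gamma>)) *
                      phi_plus \<iota> (\<gamma> ** Rmat) (- z)) powi (- \<lfloor>2 * k\<rfloor>)) (f (mobius \<gamma> z)))
     else 0)"

definition slash_SL ::
  "cover_map \<Rightarrow> (complex \<Rightarrow> 'v \<Rightarrow> 'v) \<Rightarrow> real \<Rightarrow> (complex \<Rightarrow> 'v::zero) \<Rightarrow> mat2 \<times> int \<Rightarrow> complex \<Rightarrow> 'v"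
where
  "slash_SL \<iota> smul k f = (\<lambda>(\<gamma>, \<epsilon>) z.
     if z \<in> upper_hp
     then smul ((of_int \<epsilon> * phi_plus \<iota> \<gamma> z) powi (- \<lfloor>2 * k\<rfloor>)) (f (mobius \<gamma> z))
     else 0)"

definition GL_group :: "(complex \<Rightarrow> 'v \<Rightarrow> 'v) \<Rightarrow> ('v::ab_group_add \<Rightarrow> 'v) monoid" where
  "GL_group smul =
     \<lparr>carrier = {T. Vector_Spaces.linear smul smul T \<and> bij T},
      mult = (\<circ>),
      one = id\<rparr>"

definition vec_holomorphic_on ::
  "(complex \<Rightarrow> 'v \<Rightarrow> 'v) \<Rightarrow> (complex \<Rightarrow> 'v::ab_group_add) \<Rightarrow> complex set \<Rightarrow> bool"
where
  "vec_holomorphic_on smul f H \<longleftrightarrow>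
     (\<forall>l. Vector_Spaces.linear smul (*) l \<longrightarrow> (l \<circ> f) holomorphic_on H)"

definition modular_forms_GL ::
  "cover_map \<Rightarrow> (complex \<Rightarrow> 'v \<Rightarrow> 'v) \<Rightarrow> real \<Rightarrow> (mat2 \<times> int \<Rightarrow> 'v \<Rightarrow> 'v) \<Rightarrow>
     (complex \<Rightarrow> 'v::ab_group_add) set"
where
  "modular_forms_GL \<iota> smul k \<rho> =
     {f. vanishes_off double_hp f \<and> vec_holomorphic_on smul f double_hp \<and>
         (\<forall>g\<in>carrier GL2_tilde. \<forall>z\<in>double_hp. slash_GL \<iota> smul k f g z = \<rho> g (f z))}"

text \<open>
  An element of the cover of the special linear group acts through its image under \<open>\<iota>\<close>, and
  the restriction of a representation \<open>\<rho>\<close> to this cover is \<open>\<rho> \<circ> \<iota>\<close>.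
\<close>

definition modular_forms_SL ::
  "cover_map \<Rightarrow> (complex \<Rightarrow> 'v \<Rightarrow> 'v) \<Rightarrow> real \<Rightarrow> (mat2 \<times> (complex \<Rightarrow> complex) \<Rightarrow> 'v \<Rightarrow> 'v) \<Rightarrow>
     (complex \<Rightarrow> 'v::ab_group_add) set"
where
  "modular_forms_SL \<iota> smul k \<sigma> =
     {f. vanishes_off upper_hp f \<and> vec_holomorphic_on smul f upper_hp \<and>
         (\<forall>x\<in>carrier SL2_tilde. \<forall>z\<in>upper_hp. slash_SL \<iota> smul k f (\<iota> x) z = \<sigma> x (f z))}"

definition restrict_upper :: "(complex \<Rightarrow> 'v::zero) \<Rightarrow> complex \<Rightarrow> 'v" where
  "restrict_upper f = (\<lambda>z. if z \<in> upper_hp then f z else 0)"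

definition fun_smul :: "(complex \<Rightarrow> 'v \<Rightarrow> 'v) \<Rightarrow> complex \<Rightarrow> (complex \<Rightarrow> 'v) \<Rightarrow> complex \<Rightarrow> 'v" where
  "fun_smul smul c f = (\<lambda>z. smul c (f z))"

definition subspace_isomorphism ::
  "('k::field \<Rightarrow> 'a \<Rightarrow> 'a) \<Rightarrow> 'a::ab_group_add set \<Rightarrow> ('k \<Rightarrow> 'b \<Rightarrow> 'b) \<Rightarrow> 'b::ab_group_add set \<Rightarrow>
     ('a \<Rightarrow> 'b) \<Rightarrow> bool"
where
  "subspace_isomorphism s1 S s2 T h \<longleftrightarrow>
     module.subspace s1 S \<and> module.subspace s2 T \<and>
     (\<forall>x\<in>S. \<forall>y\<in>S. h (x + y) = h x + h y) \<and> (\<forall>c. \<forall>x\<in>S. h (s1 c x) = s2 c (h x)) \<and>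
     bij_betw h S T"

end

theory Submission
  imports Defs
begin

text \<open>
  The cover of \<open>GL\<^sub>2(\<int>)\<close> is generated by the cover of \<open>SL\<^sub>2(\<int>)\<close> and one further element
  \<open>r = [R, -1]\<close>, which acts on functions by \<open>f(z) \<mapsto> i\<^sup>-\<^sup>2\<^sup>k f(-z)\<close>. The transformation law for
  \<open>r\<close> at \<open>-z\<close> therefore reads \<open>i\<^sup>-\<^sup>2\<^sup>k f(z) = \<rho>(r) f(-z)\<close>: it recovers \<open>f\<close> on the lower
  half-plane from \<open>f\<close> on the upper one. This gives injectivity of the restriction, and it
  dictates the inverse, \<open>extend\<close>: a form \<open>F\<close> on the upper half-plane is continued by
  \<open>\<rho>(r) ((-i)\<^sup>-\<^sup>2\<^sup>k F(-z))\<close>.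

  What has to be shown is that the extension obeys the law for every \<open>[\<gamma>, \<epsilon>]\<close>
  (\<open>slash_extend\<close>). Depending on \<open>det \<gamma>\<close> and on the half-plane that contains \<open>z\<close>, multiplying
  \<open>\<gamma>\<close> by \<open>R\<close> on the left, on the right, on both sides or not at all turns the law into that of \<open>F\<close>
  for a matrix of determinant 1. The automorphy factors are defined through
  the same matrices, so no relation between the functions \<open>\<phi>\<^sup>+\<close> is involved; only the
  signs must be compared, and the three sign identities \<open>sign_conj_Rmat\<close>, \<open>sign_left_Rmat\<close>
  and \<open>sign_right_Rmat\<close> say that these are the signs of the products with \<open>r\<close> in the
  cover. The law of \<open>F\<close> is stated for elements of the cover of \<open>SL\<^sub>2(\<int>)\<close>; that it holds for
  all \<open>[\<gamma>, \<epsilon>]\<close> of determinant 1 is \<open>lifting_embedding_surj\<close>.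
\<close>

section \<open>Integer matrices and the half-planes\<close>

lemma Rmat_entries [simp]:
  "Rmat $ 1 $ 1 = -1" "Rmat $ 1 $ 2 = 0" "Rmat $ 2 $ 1 = 0" "Rmat $ 2 $ 2 = 1"
  by (simp_all add: Rmat_def)

lemma matrix_mul_entries_2:
  fixes \<alpha> \<beta> :: mat2
  shows "(\<alpha> ** \<beta>) $ i $ j = \<alpha> $ i $ 1 * \<beta> $ 1 $ j + \<alpha> $ i $ 2 * \<beta> $ 2 $ j"
  by (simp add: matrix_matrix_mult_def sum_2)

lemma mat_1_entries [simp]:
  "(mat 1 :: mat2) $ 1 $ 1 = 1" "(mat 1 :: mat2) $ 1 $ 2 = 0"
  "(mat 1 :: mat2) $ 2 $ 1 = 0" "(mat 1 :: mat2) $ 2 $ 2 = 1"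
  by (simp_all add: mat_def)

lemma Rmat_involution [simp]: "Rmat ** Rmat = mat 1"
  by (simp add: vec_eq_iff forall_2 matrix_mul_entries_2 mat_def)

lemma Rmat_Rmat_mul [simp]: "Rmat ** (Rmat ** \<gamma>) = \<gamma>"
  by (simp add: matrix_mul_assoc)

lemma Rmat_mul_Rmat [simp]: "\<gamma> ** Rmat ** Rmat = \<gamma>"
  by (simp flip: matrix_mul_assoc)

lemma det_Rmat [simp]: "det Rmat = -1"
  by (simp add: det_2)

lemma invertible_Rmat [simp]: "invertible Rmat"
  unfolding invertible_def by (intro exI[of _ Rmat]) simp

lemma det_cases_of_invertible:
  fixes \<gamma> :: mat2
  assumes "invertible \<gamma>"
  shows "det \<gamma> = 1 \<or> det \<gamma> = -1"
proof -
  obtain \<delta> where "\<gamma> ** \<delta> = mat 1"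
    using assms unfolding invertible_def by blast
  then have "det \<gamma> * det \<delta> = 1"
    by (metis det_mul det_I)
  then show ?thesis
    using zmult_eq_1_iff by blast
qed

lemma open_upper_hp: "open upper_hp" and open_lower_hp: "open lower_hp"
  by (simp_all add: upper_hp_def lower_hp_def open_halfspace_Im_lt open_halfspace_Im_gt)

lemma upper_not_lower: "z \<in> upper_hp \<Longrightarrow> z \<notin> lower_hp"
  by (simp add: upper_hp_def lower_hp_def)

lemma uminus_half_planes [simp]:
  "- z \<in> upper_hp \<longleftrightarrow> z \<in> lower_hp" "- z \<in> lower_hp \<longleftrightarrow> z \<in> upper_hp"
  by (simp_all add: upper_hp_def lower_hp_def)

lemma mobius_mat_1 [simp]: "mobius (mat 1) z = z"
  by (simp add: mobius_def)

lemma mobius_Rmat_mul: "mobius (Rmat ** \<gamma>) z = - mobius \<gamma> z"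
  by (simp add: mobius_def matrix_mul_entries_2 minus_divide_left)

lemma mobius_mul_Rmat: "mobius (\<gamma> ** Rmat) (- z) = mobius \<gamma> z"
  by (simp add: mobius_def matrix_mul_entries_2)

lemma mobius_conj_Rmat: "mobius (Rmat ** \<gamma> ** Rmat) (- z) = - mobius \<gamma> z"
  by (simp add: mobius_mul_Rmat mobius_Rmat_mul)

lemma denom_nonzero:
  fixes \<gamma> :: mat2
  assumes "det \<gamma> \<noteq> 0" and "Im z \<noteq> 0"
  shows "of_int (\<gamma> $ 2 $ 1) * z + of_int (\<gamma> $ 2 $ 2) \<noteq> 0"
  using assms by (auto simp: complex_eq_iff det_2)

lemma Im_mobius:
  "Im (mobius \<gamma> z) =
     of_int (det \<gamma>) * Im z / (cmod (of_int (\<gamma> $ 2 $ 1) * z + of_int (\<gamma> $ 2 $ 2)))\<^sup>2"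
  unfolding mobius_def Im_divide cmod_power2 det_2
  by (simp add: algebra_simps)

lemma Im_mobius_sign:
  assumes "Im z \<noteq> 0" and "det \<gamma> \<noteq> 0"
  shows "Im (mobius \<gamma> z) > 0 \<longleftrightarrow> of_int (det \<gamma>) * Im z > 0"
    and "Im (mobius \<gamma> z) < 0 \<longleftrightarrow> of_int (det \<gamma>) * Im z < 0"
  using denom_nonzero[OF assms(2,1)]
  by (simp_all add: Im_mobius zero_less_divide_iff divide_less_0_iff)

lemma mobius_half_planes:
  shows "det \<gamma> = 1 \<Longrightarrow> z \<in> upper_hp \<Longrightarrow> mobius \<gamma> z \<in> upper_hp"
    and "det \<gamma> = 1 \<Longrightarrow> z \<in> lower_hp \<Longrightarrow> mobius \<gamma> z \<in> lower_hp"
    and "det \<gamma> = -1 \<Longrightarrow> z \<in> upper_hp \<Longrightarrow> mobius \<gamma> z \<in> lower_hp"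
    and "det \<gamma> = -1 \<Longrightarrow> z \<in> lower_hp \<Longrightarrow> mobius \<gamma> z \<in> upper_hp"
  using Im_mobius_sign[of z \<gamma>] by (auto simp: upper_hp_def lower_hp_def)

section \<open>Sign identities\<close>

lemma cocycle_A_Rmat_Rmat [simp]: "cocycle_A Rmat Rmat = -1"
  by (simp add: cocycle_A_def hilbert_symbol_def chi_def)

lemma cocycle_A_one [simp]: "cocycle_A (mat 1) (mat 1) = 1"
  by (simp add: cocycle_A_def hilbert_symbol_def chi_def)

lemma cocycle_A_sign: "cocycle_A \<alpha> \<beta> = 1 \<or> cocycle_A \<alpha> \<beta> = -1"
  by (simp add: cocycle_A_def hilbert_symbol_def)

lemma sign_B_sign: "sign_B \<gamma> = 1 \<or> sign_B \<gamma> = -1"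
  by (simp add: sign_B_def hilbert_symbol_def)

lemmas sign_defs =
  cocycle_A_def sign_B_def hilbert_symbol_def chi_def det_mul matrix_mul_entries_2

text \<open>
  In the cover, for \<open>det \<gamma> = 1\<close>, this is
  \<open>[R, -1] [R \<gamma> R, \<epsilon> B(\<gamma>)] = [\<gamma>, \<epsilon>] [R, -1]\<close>, that is, \<open>B\<close> describes conjugation by a lift
  of \<open>R\<close>. Both sides equal the sign of \<open>- c\<close> if \<open>c \<noteq> 0\<close>, and 1 if \<open>c = 0\<close>.
\<close>

lemma sign_conj_Rmat:
  assumes "det \<gamma> = 1"
  shows "cocycle_A Rmat (Rmat ** \<gamma> ** Rmat) * sign_B \<gamma> = cocycle_A \<gamma> Rmat"
  using assms
  by (simp add: sign_defs divide_less_0_iff matrix_mul_assoc split: if_splits)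

text \<open>
  For \<open>det \<gamma> = -1\<close> this is \<open>[R, -1] [R \<gamma>, \<epsilon> A(R, \<gamma>)] = [\<gamma>, \<epsilon>]\<close>. It holds because the second
  Hilbert symbols in the two factors agree, and only \<open>A(R, \<gamma>)\<close> has two negative determinants.
\<close>

lemma sign_left_Rmat:
  assumes "det \<gamma> = -1"
  shows "cocycle_A Rmat (Rmat ** \<gamma>) * cocycle_A Rmat \<gamma> = -1"
  using assms
  by (simp add: sign_defs divide_less_0_iff split: if_splits)

text \<open>
  For \<open>det \<gamma> = -1\<close> this is \<open>[\<gamma>, \<epsilon>] [R, -1] = [\<gamma> R, - \<epsilon> A(R, \<gamma>) B(R \<gamma>)]\<close>. Both sides equal
  the sign of \<open>- c\<close> if \<open>c \<noteq> 0\<close>, and -1 if \<open>c = 0\<close>.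
\<close>

lemma sign_right_Rmat:
  assumes "det \<gamma> = -1"
  shows "cocycle_A \<gamma> Rmat = cocycle_A Rmat \<gamma> * sign_B (Rmat ** \<gamma>)"
  using assms
  by (simp add: sign_defs divide_less_0_iff split: if_splits)

section \<open>The lifting embedding\<close>

text \<open>
  The principal square root of \<open>c z + d\<close> will do: for \<open>c \<noteq> 0\<close> this number is never real
  on the upper half-plane, and for \<open>c = 0\<close> it is constant.
\<close>

lemma SL2_tilde_lift_exists:
  assumes "det \<gamma> = 1"
  obtains \<phi> where "(\<gamma>, \<phi>) \<in> carrier SL2_tilde" "(\<gamma>, \<lambda>z. - \<phi> z) \<in> carrier SL2_tilde"
    "(\<lambda>z. - \<phi> z) \<noteq> \<phi>"
proof -
  define j where "j = (\<lambda>z::complex. of_int (\<gamma> $ 2 $ 1) * z + of_int (\<gamma> $ 2 $ 2))"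
  define \<phi> where "\<phi> = (\<lambda>z. if z \<in> upper_hp then csqrt (j z) else 0)"
  have sq: "(\<phi> z)\<^sup>2 = j z" if "z \<in> upper_hp" for z
    using that by (simp add: \<phi>_def)
  have "(\<lambda>z. csqrt (j z)) holomorphic_on upper_hp"
  proof (cases "\<gamma> $ 2 $ 1 = 0")
    case True
    then show ?thesis by (simp add: j_def)
  next
    case False
    have "j z \<notin> \<real>\<^sub>\<le>\<^sub>0" if "z \<in> upper_hp" for z
      using that False by (auto simp: j_def complex_nonpos_Reals_iff upper_hp_def)
    moreover have "j holomorphic_on upper_hp"
      unfolding j_def by (intro holomorphic_intros)
    ultimately show ?thesis by (intro holomorphic_intros) auto
  qed
  then have hol: "\<phi> holomorphic_on upper_hp"
    by (rule holomorphic_transform) (simp add: \<phi>_def)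
  have off: "vanishes_off upper_hp \<phi>"
    by (simp add: vanishes_off_def \<phi>_def)
  have "(\<gamma>, \<phi>) \<in> carrier SL2_tilde" "(\<gamma>, \<lambda>z. - \<phi> z) \<in> carrier SL2_tilde"
    using assms hol off sq
    by (auto simp: SL2_tilde_def vanishes_off_def j_def intro!: holomorphic_intros)
  moreover have "- \<phi> \<i> \<noteq> \<phi> \<i>"
    using denom_nonzero[of \<gamma> \<i>] sq[of \<i>] assms by (auto simp: j_def upper_hp_def)
  then have "(\<lambda>z. - \<phi> z) \<noteq> \<phi>" by metis
  ultimately show thesis using that by blast
qed

lemma lifting_embedding_carrier:
  assumes "lifting_embedding \<iota>" and "x \<in> carrier SL2_tilde"
  shows "\<iota> x \<in> carrier GL2_tilde" and "det (fst (\<iota> x)) = 1"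
  using assms by (auto simp: lifting_embedding_def hom_def SL2_tilde_def)

text \<open>
  The two lifts of \<open>\<gamma>\<close> have distinct images over \<open>\<gamma>\<close>, where there is room for only two.
\<close>

lemma lifting_embedding_surj:
  assumes "lifting_embedding \<iota>" and "det \<gamma> = 1" and "\<epsilon> \<in> {1, -1}"
  obtains x where "x \<in> carrier SL2_tilde" and "\<iota> x = (\<gamma>, \<epsilon>)"
proof -
  obtain \<phi> where \<phi>: "(\<gamma>, \<phi>) \<in> carrier SL2_tilde" "(\<gamma>, \<lambda>z. - \<phi> z) \<in> carrier SL2_tilde"
    "(\<lambda>z. - \<phi> z) \<noteq> \<phi>"
    using SL2_tilde_lift_exists[OF assms(2)] by blast
  have fst: "fst (\<iota> (\<gamma>, \<phi>)) = \<gamma>" "fst (\<iota> (\<gamma>, \<lambda>z. - \<phi> z)) = \<gamma>"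
    using assms(1) \<phi>(1,2) by (auto simp: lifting_embedding_def)
  have snd: "snd (\<iota> (\<gamma>, \<phi>)) \<in> {1, -1}" "snd (\<iota> (\<gamma>, \<lambda>z. - \<phi> z)) \<in> {1, -1}"
    using lifting_embedding_carrier(1)[OF assms(1)] \<phi>(1,2)
    by (fastforce simp: GL2_tilde_def mem_Times_iff)+
  have "\<iota> (\<gamma>, \<phi>) \<noteq> \<iota> (\<gamma>, \<lambda>z. - \<phi> z)"
    using assms(1) \<phi> by (fastforce simp: lifting_embedding_def dest: inj_onD)
  then have "\<iota> (\<gamma>, \<phi>) = (\<gamma>, \<epsilon>) \<or> \<iota> (\<gamma>, \<lambda>z. - \<phi> z) = (\<gamma>, \<epsilon>)"
    using fst snd assms(3) by (auto simp: prod_eq_iff)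
  then show thesis using \<phi> that by blast
qed

text \<open>
  The sign in the image of the identity is 1 because that image is idempotent.
\<close>

lemma phi_plus_one:
  assumes \<iota>: "lifting_embedding \<iota>"
  shows "phi_plus \<iota> (mat 1) = (\<lambda>z. if z \<in> upper_hp then 1 else 0)" (is "_ = ?e")
proof -
  have e: "(mat 1, ?e) \<in> carrier SL2_tilde"
    by (auto simp: SL2_tilde_def vanishes_off_def intro: holomorphic_transform[of "\<lambda>_. 1"])
  have "(mat 1, ?e) \<otimes>\<^bsub>SL2_tilde\<^esub> (mat 1, ?e) = (mat 1, ?e)"
    by (auto simp: SL2_tilde_def)
  then have idem: "\<iota> (mat 1, ?e) \<otimes>\<^bsub>GL2_tilde\<^esub> \<iota> (mat 1, ?e) = \<iota> (mat 1, ?e)"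
    using \<iota> e unfolding lifting_embedding_def by (metis hom_mult)
  obtain \<epsilon> where \<epsilon>: "\<iota> (mat 1, ?e) = (mat 1, \<epsilon>)"
    using \<iota> e unfolding lifting_embedding_def by (metis fst_conv prod.exhaust_sel)
  have "\<epsilon> \<in> {1, -1}"
    using lifting_embedding_carrier(1)[OF \<iota> e] by (simp add: \<epsilon> GL2_tilde_def)
  then have img: "\<iota> (mat 1, ?e) = (mat 1, 1)"
    using idem by (auto simp: \<epsilon> GL2_tilde_def)
  show ?thesis
    unfolding phi_plus_def
  proof (rule the_equality)
    show "(mat 1, ?e) \<in> carrier SL2_tilde \<and> \<iota> (mat 1, ?e) = (mat 1, 1)"
      using e img by blast
  next
    fix \<phi> assume "(mat 1, \<phi>) \<in> carrier SL2_tilde \<and> \<iota> (mat 1, \<phi>) = (mat 1, 1)"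
    then have "(mat 1, \<phi>) = (mat 1 :: mat2, ?e)"
      using \<iota> e img unfolding lifting_embedding_def by (metis inj_onD)
    then show "\<phi> = ?e" by simp
  qed
qed

section \<open>Modular forms\<close>

locale GL2_tilde_representation =
  fixes smul :: "complex \<Rightarrow> 'v::ab_group_add \<Rightarrow> 'v"
    and \<iota> :: cover_map
    and \<rho> :: "mat2 \<times> int \<Rightarrow> 'v \<Rightarrow> 'v"
    and k :: real
  assumes vector_space: "vector_space smul"
    and embedding: "lifting_embedding \<iota>"
    and rep: "\<rho> \<in> hom GL2_tilde (GL_group smul)"
begin

sublocale V: vector_space smul by (rule vector_space)

abbreviation "M_GL \<equiv> modular_forms_GL \<iota> smul k \<rho>"
abbreviation "M_SL \<equiv> modular_forms_SL \<iota> smul k (\<rho> \<circ> \<iota>)"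

lemma rep_linear:
  assumes "invertible \<gamma>" and "\<epsilon> \<in> {1, -1}"
  shows "\<rho> (\<gamma>, \<epsilon>) (u + v) = \<rho> (\<gamma>, \<epsilon>) u + \<rho> (\<gamma>, \<epsilon>) v"
    and "\<rho> (\<gamma>, \<epsilon>) (smul c u) = smul c (\<rho> (\<gamma>, \<epsilon>) u)"
    and "\<rho> (\<gamma>, \<epsilon>) 0 = 0"
proof -
  have "(\<gamma>, \<epsilon>) \<in> carrier GL2_tilde"
    using assms by (simp add: GL2_tilde_def)
  then have lin: "Vector_Spaces.linear smul smul (\<rho> (\<gamma>, \<epsilon>))"
    using rep by (auto simp: hom_def GL_group_def)
  show "\<rho> (\<gamma>, \<epsilon>) (u + v) = \<rho> (\<gamma>, \<epsilon>) u + \<rho> (\<gamma>, \<epsilon>) v"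
    and sc: "\<rho> (\<gamma>, \<epsilon>) (smul c u) = smul c (\<rho> (\<gamma>, \<epsilon>) u)" for c u
    using lin by (simp_all add: Vector_Spaces.linear_iff)
  show "\<rho> (\<gamma>, \<epsilon>) 0 = 0"
    using sc[of 0 0] by simp
qed

lemma rep_mult:
  assumes "invertible \<alpha>" "invertible \<beta>" "\<epsilon> \<in> {1, -1}" "\<delta> \<in> {1, -1}"
  shows "\<rho> (\<alpha>, \<epsilon>) (\<rho> (\<beta>, \<delta>) v) = \<rho> (\<alpha> ** \<beta>, cocycle_A \<alpha> \<beta> * \<epsilon> * \<delta>) v"
proof -
  have "\<rho> ((\<alpha>, \<epsilon>) \<otimes>\<^bsub>GL2_tilde\<^esub> (\<beta>, \<delta>)) = \<rho> (\<alpha>, \<epsilon>) \<circ> \<rho> (\<beta>, \<delta>)"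
    using hom_mult[OF rep, of "(\<alpha>, \<epsilon>)" "(\<beta>, \<delta>)"] assms by (simp add: GL2_tilde_def GL_group_def)
  then show ?thesis by (simp add: GL2_tilde_def fun_eq_iff)
qed

lemma M_SL_transform:
  assumes F: "F \<in> M_SL" and "det \<gamma> = 1" and "\<epsilon> \<in> {1, -1}" and "z \<in> upper_hp"
  shows "smul ((of_int \<epsilon> * phi_plus \<iota> \<gamma> z) powi (- \<lfloor>2 * k\<rfloor>)) (F (mobius \<gamma> z)) = \<rho> (\<gamma>, \<epsilon>) (F z)"
proof -
  obtain x where "x \<in> carrier SL2_tilde" and x: "\<iota> x = (\<gamma>, \<epsilon>)"
    using lifting_embedding_surj[OF embedding assms(2,3)] .
  then have "slash_SL \<iota> smul k F (\<iota> x) z = (\<rho> \<circ> \<iota>) x (F z)"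
    using F assms(4) unfolding modular_forms_SL_def by blast
  then show ?thesis
    using assms(4) by (simp add: x slash_SL_def)
qed

text \<open>
  Since the identity of the cover is \<open>[R, 1] [R, -1]\<close>, the operator \<open>\<rho>(R, -1)\<close> is the inverse of
  \<open>\<rho>(R, 1)\<close>; writing it this way keeps all computations inside the values of \<open>\<rho>\<close>.
\<close>

definition extend :: "(complex \<Rightarrow> 'v) \<Rightarrow> complex \<Rightarrow> 'v" where
  "extend F = (\<lambda>z. if z \<in> upper_hp then F z
     else if z \<in> lower_hp then \<rho> (Rmat, -1) (smul ((- \<i>) powi (- \<lfloor>2 * k\<rfloor>)) (F (- z)))
     else 0)"

lemma extend_upper: "z \<in> upper_hp \<Longrightarrow> extend F z = F z"
  by (simp add: extend_def)

lemma extend_lower: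
  "z \<in> lower_hp \<Longrightarrow> extend F z = \<rho> (Rmat, -1) (smul ((- \<i>) powi (- \<lfloor>2 * k\<rfloor>)) (F (- z)))"
  using upper_not_lower by (auto simp: extend_def)

text \<open>
  The cases are named by the half-planes of \<open>z\<close> and of \<open>\<gamma> z\<close>. In all but the first, \<open>\<delta>\<close> collects
  the signs in the automorphy factor, so that \<open>F\<close> can be transformed by an
  element \<open>[\<dots>, \<delta>]\<close> of the cover, and the sign identity for the case moves \<open>[R, -1]\<close> past it.
\<close>

lemma slash_extend:
  assumes F: "F \<in> M_SL" and inv: "invertible \<gamma>" and \<epsilon>: "\<epsilon> \<in> {1, -1}" and z: "z \<in> double_hp"
  shows "slash_GL \<iota> smul k (extend F) (\<gamma>, \<epsilon>) z = \<rho> (\<gamma>, \<epsilon>) (extend F z)"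
proof -
  let ?n = "- \<lfloor>2 * k\<rfloor>"
  have R_scale: "\<rho> (Rmat, -1) (smul c v) = smul c (\<rho> (Rmat, -1) v)" for c v
    using rep_linear[of Rmat "-1"] by auto
  have invs: "invertible (Rmat ** \<gamma>)" "invertible (\<gamma> ** Rmat)" "invertible (Rmat ** \<gamma> ** Rmat)"
    using inv by (simp_all add: invertible_mult)
  consider (uu) "det \<gamma> = 1" "z \<in> upper_hp" | (ll) "det \<gamma> = 1" "z \<in> lower_hp"
    | (ul) "det \<gamma> = -1" "z \<in> upper_hp" | (lu) "det \<gamma> = -1" "z \<in> lower_hp"
    using det_cases_of_invertible[OF inv] z by (auto simp: double_hp_def)
  then show ?thesis
  proof cases
    case uu
    then show ?thesis
      using M_SL_transform[OF F uu(1) \<epsilon> uu(2)]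
      by (simp add: slash_GL_def extend_upper mobius_half_planes)
  next
    case ll
    define \<delta> where "\<delta> = \<epsilon> * sign_B \<gamma>"
    have \<delta>: "\<delta> \<in> {1, -1}" using \<epsilon> sign_B_sign[of \<gamma>] by (auto simp: \<delta>_def)
    let ?w = "of_int \<delta> * phi_plus \<iota> (Rmat ** \<gamma> ** Rmat) (- z)"
    have "slash_GL \<iota> smul k (extend F) (\<gamma>, \<epsilon>) z =
        smul (?w powi ?n) (\<rho> (Rmat, -1) (smul ((- \<i>) powi ?n) (F (- mobius \<gamma> z))))"
      using ll upper_not_lower[of z] mobius_half_planes(2)[OF ll]
      by (auto simp: slash_GL_def extend_lower \<delta>_def)
    also have "\<dots> = smul ((- \<i>) powi ?n) (\<rho> (Rmat, -1) (smul (?w powi ?n) (F (- mobius \<gamma> z))))"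
      by (simp add: R_scale mult.commute)
    also have "\<dots> = smul ((- \<i>) powi ?n) (\<rho> (Rmat, -1) (\<rho> (Rmat ** \<gamma> ** Rmat, \<delta>) (F (- z))))"
      using M_SL_transform[OF F _ \<delta>, of "Rmat ** \<gamma> ** Rmat" "- z"] ll
      by (simp add: det_mul mobius_conj_Rmat)
    also have "\<rho> (Rmat, -1) (\<rho> (Rmat ** \<gamma> ** Rmat, \<delta>) (F (- z))) = \<rho> (\<gamma>, \<epsilon>) (\<rho> (Rmat, -1) (F (- z)))"
      using sign_conj_Rmat[OF ll(1)] invs inv \<epsilon> \<delta>
      by (simp add: rep_mult \<delta>_def ac_simps flip: matrix_mul_assoc)
    finally show ?thesis
      using ll inv \<epsilon> by (simp add: extend_lower R_scale rep_linear)
  next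
    case ul
    define \<delta> where "\<delta> = \<epsilon> * cocycle_A Rmat \<gamma>"
    have \<delta>: "\<delta> \<in> {1, -1}" using \<epsilon> cocycle_A_sign[of Rmat \<gamma>] by (auto simp: \<delta>_def)
    let ?w = "of_int \<delta> * phi_plus \<iota> (Rmat ** \<gamma>) z"
    have "slash_GL \<iota> smul k (extend F) (\<gamma>, \<epsilon>) z =
        smul ((\<i> * ?w) powi ?n) (\<rho> (Rmat, -1) (smul ((- \<i>) powi ?n) (F (- mobius \<gamma> z))))"
      using ul mobius_half_planes(3)[OF ul]
      by (simp add: slash_GL_def extend_lower \<delta>_def mult.assoc)
    also have "\<dots> = \<rho> (Rmat, -1) (smul (((- \<i>) * (\<i> * ?w)) powi ?n) (F (- mobius \<gamma> z)))"
      unfolding power_int_mult_distrib by (simp add: R_scale ac_simps)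
    also have "(- \<i>) * (\<i> * ?w) = ?w"
      by (simp add: algebra_simps)
    also have "smul (?w powi ?n) (F (- mobius \<gamma> z)) = \<rho> (Rmat ** \<gamma>, \<delta>) (F z)"
      using M_SL_transform[OF F _ \<delta>, of "Rmat ** \<gamma>" z] ul
      by (simp add: det_mul mobius_Rmat_mul)
    also have "\<rho> (Rmat, -1) (\<rho> (Rmat ** \<gamma>, \<delta>) (F z)) = \<rho> (\<gamma>, \<epsilon>) (F z)"
      using sign_left_Rmat[OF ul(1)] invs \<delta>
      by (simp add: rep_mult \<delta>_def mult.left_commute)
    finally show ?thesis using ul by (simp add: extend_upper)
  next
    case lu
    \<comment> \<open>The extra minus sign replaces the factor \<open>\<i>\<close> of the action by the factor \<open>- \<i>\<close> that
      appears in the extension.\<close>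
    define \<delta> where "\<delta> = - \<epsilon> * cocycle_A Rmat \<gamma> * sign_B (Rmat ** \<gamma>)"
    have \<delta>: "\<delta> \<in> {1, -1}"
      using \<epsilon> cocycle_A_sign[of Rmat \<gamma>] sign_B_sign[of "Rmat ** \<gamma>"] by (auto simp: \<delta>_def)
    let ?w = "of_int \<delta> * phi_plus \<iota> (\<gamma> ** Rmat) (- z)"
    have "slash_GL \<iota> smul k (extend F) (\<gamma>, \<epsilon>) z = smul (((- \<i>) * ?w) powi ?n) (F (mobius \<gamma> z))"
      using lu upper_not_lower[of z] mobius_half_planes(4)[OF lu]
      by (auto simp: slash_GL_def extend_upper \<delta>_def mult.assoc)
    also have "\<dots> = smul ((- \<i>) powi ?n) (smul (?w powi ?n) (F (mobius \<gamma> z)))"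
      unfolding power_int_mult_distrib by simp
    also have "smul (?w powi ?n) (F (mobius \<gamma> z)) = \<rho> (\<gamma> ** Rmat, \<delta>) (F (- z))"
      using M_SL_transform[OF F _ \<delta>, of "\<gamma> ** Rmat" "- z"] lu
      by (simp add: det_mul mobius_mul_Rmat)
    also have "\<dots> = \<rho> (\<gamma>, \<epsilon>) (\<rho> (Rmat, -1) (F (- z)))"
      using sign_right_Rmat[OF lu(1)] inv \<epsilon>
      by (simp add: rep_mult \<delta>_def ac_simps)
    finally show ?thesis
      using lu inv \<epsilon> by (simp add: extend_lower R_scale rep_linear)
  qed
qed

lemma vec_holomorphic_extend:
  assumes hol: "vec_holomorphic_on smul F upper_hp"
  shows "vec_holomorphic_on smul (extend F) double_hp"
  unfolding vec_holomorphic_on_def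
proof (intro allI impI)
  fix l :: "'v \<Rightarrow> complex" assume l: "Vector_Spaces.linear smul (*) l"
  \<comment> \<open>On the lower half-plane the extension is \<open>F(-z)\<close> under a fixed linear operator, which
    the functional \<open>l\<close> absorbs.\<close>
  define l' where "l' = (\<lambda>v. l (\<rho> (Rmat, -1) (smul ((- \<i>) powi (- \<lfloor>2 * k\<rfloor>)) v)))"
  have l': "Vector_Spaces.linear smul (*) l'"
    using l by (simp add: Vector_Spaces.linear_iff l'_def rep_linear V.scale_right_distrib
        algebra_simps del: V.scale_scale)
  have up: "(l \<circ> extend F) holomorphic_on upper_hp"
    using hol l unfolding vec_holomorphic_on_def
    by (auto intro: holomorphic_transform[of "l \<circ> F"] simp: extend_upper)
  have "(l' \<circ> F) \<circ> uminus holomorphic_on lower_hp"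
  proof (rule holomorphic_on_compose_gen)
    show "l' \<circ> F holomorphic_on upper_hp"
      using hol l' unfolding vec_holomorphic_on_def by blast
  qed (auto intro!: holomorphic_intros)
  then have low: "(l \<circ> extend F) holomorphic_on lower_hp"
    by (rule holomorphic_transform) (simp add: l'_def extend_lower)
  show "(l \<circ> extend F) holomorphic_on double_hp"
    unfolding double_hp_def using up low open_upper_hp open_lower_hp by (intro holomorphic_on_Un)
qed

lemma extend_in_M_GL:
  assumes "F \<in> M_SL"
  shows "extend F \<in> M_GL"
  using assms slash_extend[OF assms] vec_holomorphic_extend[of F]
  by (auto simp: modular_forms_GL_def modular_forms_SL_def GL2_tilde_def vanishes_off_def
      double_hp_def extend_def)

lemma restrict_in_M_SL:
  assumes f: "f \<in> M_GL"
  shows "restrict_upper f \<in> M_SL"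
proof -
  have "slash_SL \<iota> smul k (restrict_upper f) (\<iota> x) z = (\<rho> \<circ> \<iota>) x (restrict_upper f z)"
    if x: "x \<in> carrier SL2_tilde" and z: "z \<in> upper_hp" for x z
  proof -
    obtain \<gamma> \<epsilon> where g: "\<iota> x = (\<gamma>, \<epsilon>)" by fastforce
    have "slash_GL \<iota> smul k f (\<gamma>, \<epsilon>) z = \<rho> (\<gamma>, \<epsilon>) (f z)"
      using f lifting_embedding_carrier(1)[OF embedding x] z
      by (auto simp: modular_forms_GL_def double_hp_def g)
    then show ?thesis
      using lifting_embedding_carrier(2)[OF embedding x] z
      by (simp add: g slash_GL_def slash_SL_def restrict_upper_def mobius_half_planes)
  qed
  moreover have "vec_holomorphic_on smul (restrict_upper f) upper_hp"
    unfolding vec_holomorphic_on_def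
  proof (intro allI impI)
    fix l :: "'v \<Rightarrow> complex" assume "Vector_Spaces.linear smul (*) l"
    then have "(l \<circ> f) holomorphic_on upper_hp"
      using f unfolding modular_forms_GL_def vec_holomorphic_on_def double_hp_def
      by (auto intro: holomorphic_on_subset)
    then show "(l \<circ> restrict_upper f) holomorphic_on upper_hp"
      by (rule holomorphic_transform) (simp add: restrict_upper_def)
  qed
  ultimately show ?thesis
    by (simp add: modular_forms_SL_def vanishes_off_def restrict_upper_def)
qed

lemma restrict_extend:
  assumes "F \<in> M_SL"
  shows "restrict_upper (extend F) = F"
  using assms by (auto simp: restrict_upper_def extend_def modular_forms_SL_def vanishes_off_def)

text \<open>
  The law for \<open>[R, -1]\<close> at \<open>-z\<close>, where the automorphy factor is \<open>i\<close>: the sign -1 of the element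
  cancels against \<open>A(R, R) = -1\<close>.
\<close>

lemma extend_restrict:
  assumes f: "f \<in> M_GL"
  shows "extend (restrict_upper f) = f"
proof
  fix z
  consider "z \<in> upper_hp" | (low) "z \<in> lower_hp" | "z \<notin> double_hp"
    by (auto simp: double_hp_def)
  then show "extend (restrict_upper f) z = f z"
  proof cases
    case low
    let ?n = "- \<lfloor>2 * k\<rfloor>"
    have "slash_GL \<iota> smul k f (Rmat, -1) (- z) = \<rho> (Rmat, -1) (f (- z))"
      using f low by (auto simp: modular_forms_GL_def GL2_tilde_def double_hp_def)
    then have "smul (\<i> powi ?n) (f z) = \<rho> (Rmat, -1) (f (- z))"
      using low by (simp add: slash_GL_def phi_plus_one[OF embedding] mobius_def)
    then have "extend (restrict_upper f) z = smul (((- \<i>) * \<i>) powi ?n) (f z)"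
      unfolding power_int_mult_distrib
      using low by (simp add: extend_lower restrict_upper_def rep_linear flip: V.scale_scale)
    then show ?thesis by simp
  qed (use f in \<open>auto simp: extend_def restrict_upper_def modular_forms_GL_def vanishes_off_def
        double_hp_def\<close>)
qed

lemma fun_smul_apply: "fun_smul smul c f z = smul c (f z)"
  by (simp add: fun_smul_def)

lemma module_fun_smul: "module (fun_smul smul)"
  by unfold_locales
    (simp_all add: fun_smul_def fun_eq_iff V.scale_right_distrib V.scale_left_distrib)

lemma vec_holomorphic_on_linear_comb:
  shows "vec_holomorphic_on smul 0 H"
    and "vec_holomorphic_on smul f H \<Longrightarrow> vec_holomorphic_on smul g H \<Longrightarrow>
      vec_holomorphic_on smul (f + g) H"
    and "vec_holomorphic_on smul f H \<Longrightarrow> vec_holomorphic_on smul (fun_smul smul c f) H"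
  by (auto simp: vec_holomorphic_on_def o_def Vector_Spaces.linear_iff fun_smul_def
      intro!: holomorphic_intros)

lemma slash_GL_linear:
  shows "slash_GL \<iota> smul k 0 g z = 0"
    and "slash_GL \<iota> smul k (f + h) g z = slash_GL \<iota> smul k f g z + slash_GL \<iota> smul k h g z"
    and "slash_GL \<iota> smul k (fun_smul smul c f) g z = smul c (slash_GL \<iota> smul k f g z)"
  by (auto simp: slash_GL_def fun_smul_def V.scale_right_distrib V.scale_left_commute
      split: prod.split)

lemma subspace_M_GL: "module.subspace (fun_smul smul) M_GL"
proof -
  interpret W: module "fun_smul smul" by (rule module_fun_smul)
  have "\<rho> g 0 = 0" "\<rho> g (u + v) = \<rho> g u + \<rho> g v" "\<rho> g (smul c u) = smul c (\<rho> g u)"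
    if "g \<in> carrier GL2_tilde" for g u v c
    using that rep_linear by (auto simp: GL2_tilde_def)
  then show ?thesis
    by (auto simp: W.subspace_def modular_forms_GL_def vanishes_off_def fun_smul_apply
        slash_GL_linear vec_holomorphic_on_linear_comb)
qed

lemma restrict_linear:
  shows "restrict_upper (f + g) = restrict_upper f + restrict_upper g"
    and "restrict_upper (fun_smul smul c f) = fun_smul smul c (restrict_upper f)"
  by (auto simp: restrict_upper_def fun_smul_def)

lemma restrict_bij: "bij_betw restrict_upper M_GL M_SL"
  by (rule bij_betw_byWitness[of _ extend])
    (use restrict_in_M_SL extend_in_M_GL restrict_extend extend_restrict in auto)

end

theorem theoremV1:
  fixes k :: real
    and smul :: "complex \<Rightarrow> 'v::ab_group_add \<Rightarrow> 'v"
    and \<iota> :: "mat2 \<times> (complex \<Rightarrow> complex) \<Rightarrow> mat2 \<times> int"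
    and \<rho> :: "mat2 \<times> int \<Rightarrow> 'v \<Rightarrow> 'v"
  assumes "2 * k \<in> \<int>"
    and "vector_space smul"
    and "lifting_embedding \<iota>"
    and "\<rho> \<in> hom GL2_tilde (GL_group smul)"
  shows "subspace_isomorphism
           (fun_smul smul) (modular_forms_GL \<iota> smul k \<rho>)
           (fun_smul smul) (modular_forms_SL \<iota> smul k (\<rho> \<circ> \<iota>))
           restrict_upper"
proof -
  interpret GL2_tilde_representation smul \<iota> \<rho> k
    using assms by (simp add: GL2_tilde_representation_def)
  interpret W: module "fun_smul smul" by (rule module_fun_smul)
  have "restrict_upper ` M_GL = M_SL"
    using restrict_bij by (rule bij_betw_imp_surj_on)
  moreover have "W.subspace (restrict_upper ` M_GL)"
  proof -
    have "module_hom (fun_smul smul) (fun_smul smul) restrict_upper"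
      by unfold_locales (simp_all add: restrict_linear)
    then show ?thesis
      using subspace_M_GL by (rule module_hom.subspace_image)
  qed
  ultimately show ?thesis
    using subspace_M_GL restrict_bij by (simp add: subspace_isomorphism_def restrict_linear)
qed

end
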